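(* For $\sigma\in\{0,1\}$ let $\mathsf r^4_\sigma(q)=\sum_{n\ge0}r^4_\sigma(n)q^n=\sum q^{\mathrm{rk}(\boldsymbol\sigma)}$, summed over all $\boldsymbol\sigma\in\mathbb Z^4$ with $\sigma_1+\sigma_2+\sigma_3+\sigma_4=\sigma$. (i) $\mathsf r^4_0(q^2)=\sum_{(x,y,z)\in\mathbb Z^3,\ x+y+z\text{ even}}q^{x^2+y^2+z^2}$, which is the Theta series of the face-centered cubic lattice; thus $r^4_0(n)$ is the number of points of that lattice at distance $\sqrt{2n}$ from the origin. Moreover $$\mathsf r^4_0(q)=\phi(q^2)^3+12q\,\phi(q^2)\,\psi(q^4)^2 .$$ (ii) $\mathsf r^4_1(q)=4\,\mathsf c_2(q)^3=4\,\psi(q)^3$, and $r^4_1(n)$ is four times the number of ways to write $n$ as a sum of three triangular numbers (counted as ordered triples).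
   Context: For $\boldsymbol\sigma=(\sigma_1,\dots,\sigma_\ell)\in\mathbb Z^\ell$, the rank is $\mathrm{rk}(\boldsymbol\sigma)=\left\lceil\frac{Y-\ell+1}{2\ell}\right\rceil$ where $Y=\sum_{i=1}^{\ell}\sum_{j\ne i}\sigma_i(\sigma_i-\sigma_j)$ (here $\ell=4$). $\phi(q)=\sum_{n\in\mathbb Z}q^{n^2}$ and $\psi(q)=\sum_{t\ge0}q^{t(t+1)/2}$. $\mathsf c_2(q)=\sum q^{|\lambda|}$ over partitions $\lambda$ with no removable rim hook of length 2 (2-cores). The face-centered cubic lattice is $\{(x,y,z)\in\mathbb Z^3 : x+y+z\text{ even}\}$ and the Theta series of a lattice $\Lambda$ is $\sum_{v\in\Lambda}q^{\|v\|}$ with $\|v\|$ the squared Euclidean length. Triangular numbers are $t(t+1)/2$, $t\ge0$. *)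

theory Defs
  imports "HOL-Analysis.Analysis"
begin

text \<open>
  The formal power series \<open>\<Sum>x\<in>A. q^(w x)\<close>. As \<open>card\<close> of an infinite set is 0, this reading is
  justified only if the weights on \<open>A\<close> are natural numbers and each is attained finitely often;
  \<open>gf_wf\<close> expresses this, and it is proved below for every instance.
\<close>

definition gf :: "'a set \<Rightarrow> ('a \<Rightarrow> 'b::semiring_char_0) \<Rightarrow> int fps" where
  "gf A w = Abs_fps (\<lambda>n. int (card {x\<in>A. w x = of_nat n}))"

definition gf_wf :: "'a set \<Rightarrow> ('a \<Rightarrow> 'b::semiring_char_0) \<Rightarrow> bool" where
  "gf_wf A w \<longleftrightarrow> w ` A \<subseteq> \<nat> \<and> (\<forall>n. finite {x\<in>A. w x = of_nat n})"

definition phi :: "int fps" where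
  "phi = gf (UNIV :: int set) (\<lambda>n. n\<^sup>2)"

definition psi :: "int fps" where
  "psi = gf (UNIV :: nat set) (\<lambda>t. t * (t + 1) div 2)"

definition triangular :: "nat set" where
  "triangular = {t * (t + 1) div 2 | t. True}"

definition rank_Y :: "int ^ 'l \<Rightarrow> int" where
  "rank_Y \<sigma> = (\<Sum>i\<in>UNIV. \<Sum>j\<in>UNIV - {i}. \<sigma> $ i * (\<sigma> $ i - \<sigma> $ j))"

definition rk :: "int ^ 'l \<Rightarrow> int" where
  "rk \<sigma> = \<lceil>(real_of_int (rank_Y \<sigma>) - real CARD('l) + 1) / (2 * real CARD('l))\<rceil>"

definition r4_index :: "int \<Rightarrow> (int ^ 4) set" where
  "r4_index s = {\<sigma>. (\<Sum>i\<in>UNIV. \<sigma> $ i) = s}"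

definition r4 :: "int \<Rightarrow> int fps" where
  "r4 s = gf (r4_index s) rk"

definition fcc_int :: "(int \<times> int \<times> int) set" where
  "fcc_int = {(x, y, z). even (x + y + z)}"

definition fcc_lattice :: "(real ^ 3) set" where
  "fcc_lattice = (\<lambda>(x, y, z). vector [of_int x, of_int y, of_int z]) ` fcc_int"

text \<open>
  The exponent is the squared Euclidean length, so this is the full Theta series only for lattices
  all of whose vectors have integral squared length.
\<close>

definition theta_series :: "(real ^ 'n) set \<Rightarrow> int fps" where
  "theta_series \<Lambda> = gf \<Lambda> (\<lambda>v. (norm v)\<^sup>2)"

text \<open>
  A partition is its weakly decreasing list of positive parts. A rim hook of length \<open>t\<close> is
  removable if it consists of \<open>t\<close> edge-connected cells, contains no 2-by-2 block, and deleting it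
  leaves the diagram of a partition.
\<close>

definition is_partition :: "nat list \<Rightarrow> bool" where
  "is_partition p \<longleftrightarrow> sorted_wrt (\<ge>) p \<and> 0 \<notin> set p"

definition young_diagram :: "nat list \<Rightarrow> (nat \<times> nat) set" where
  "young_diagram p = {(i, j). i < length p \<and> j < p ! i}"

definition cell_adj :: "((nat \<times> nat) \<times> (nat \<times> nat)) set" where
  "cell_adj = {((i, j), (i', j')).
     (i = i' \<and> (j = Suc j' \<or> j' = Suc j)) \<or> (j = j' \<and> (i = Suc i' \<or> i' = Suc i))}"

definition cells_connected :: "(nat \<times> nat) set \<Rightarrow> bool" where
  "cells_connected R \<longleftrightarrow> (\<forall>a\<in>R. \<forall>b\<in>R. (a, b) \<in> (cell_adj \<inter> R \<times> R)\<^sup>*)"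

definition no_2x2_block :: "(nat \<times> nat) set \<Rightarrow> bool" where
  "no_2x2_block R \<longleftrightarrow> \<not> (\<exists>i j. {(i, j), (i, Suc j), (Suc i, j), (Suc i, Suc j)} \<subseteq> R)"

definition removable_rim_hook :: "nat list \<Rightarrow> nat \<Rightarrow> (nat \<times> nat) set \<Rightarrow> bool" where
  "removable_rim_hook p t R \<longleftrightarrow>
     R \<subseteq> young_diagram p \<and> card R = t \<and> R \<noteq> {} \<and> cells_connected R \<and> no_2x2_block R \<and>
     (\<exists>p'. is_partition p' \<and> young_diagram p' = young_diagram p - R)"

definition t_core :: "nat \<Rightarrow> nat list \<Rightarrow> bool" where
  "t_core t p \<longleftrightarrow> is_partition p \<and> \<not> (\<exists>R. removable_rim_hook p t R)"

definition c2 :: "int fps" where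
  "c2 = gf {p. t_core 2 p} sum_list"

lemma int_sq_le: "\<bar>x\<bar> \<le> x\<^sup>2" for x :: int
  using self_le_power[of "\<bar>x\<bar>" 2] by (cases "x = 0") auto

lemma nonneg_in_Nats: "0 \<le> x \<Longrightarrow> x \<in> \<nat>" for x :: int
  by (metis of_nat_in_Nats zero_le_imp_eq_int)

lemma sq_le_imp_interval: "x\<^sup>2 \<le> b \<Longrightarrow> x \<in> {-b..b}" for x b :: int
  using int_sq_le[of x] by auto

lemma gf_wf_phi: "gf_wf (UNIV :: int set) (\<lambda>n. n\<^sup>2)"
  unfolding gf_wf_def
proof (intro conjI allI)
  show "range (\<lambda>n::int. n\<^sup>2) \<subseteq> \<nat>" by (auto intro!: nonneg_in_Nats)
  fix n
  have "{x\<in>UNIV. x\<^sup>2 = int n} \<subseteq> {- int n..int n}"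
    by (intro subsetI sq_le_imp_interval) simp
  then show "finite {x\<in>UNIV. x\<^sup>2 = int n}" using finite_subset by blast
qed

lemma gf_wf_psi: "gf_wf (UNIV :: nat set) (\<lambda>t. t * (t + 1) div 2)"
  unfolding gf_wf_def
proof (intro conjI allI)
  show "range (\<lambda>t::nat. t * (t + 1) div 2) \<subseteq> \<nat>"
    by (auto simp: Nats_def)
  fix n
  have "t \<le> t * (t + 1) div 2" for t :: nat
    by (cases t) (auto simp: algebra_simps)
  then have "{t\<in>UNIV. t * (t + 1) div 2 = of_nat n} \<subseteq> {..n}" by force
  then show "finite {t\<in>UNIV. t * (t + 1) div 2 = (of_nat n :: nat)}" using finite_subset by blast
qed

lemma rank_Y_4: "rank_Y \<sigma> = 4 * (\<Sum>i\<in>UNIV. (\<sigma> $ i)\<^sup>2) - (\<Sum>i\<in>UNIV. \<sigma> $ i)\<^sup>2" for \<sigma> :: "int ^ 4"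
proof -
  have "(\<Sum>j\<in>UNIV - {i}. \<sigma> $ i * (\<sigma> $ i - \<sigma> $ j)) = (\<Sum>j\<in>UNIV. \<sigma> $ i * (\<sigma> $ i - \<sigma> $ j))" for i
    by (rule sum.mono_neutral_left) auto
  then have "rank_Y \<sigma> = (\<Sum>i\<in>UNIV. \<Sum>j\<in>UNIV. \<sigma> $ i * (\<sigma> $ i - \<sigma> $ j))"
    by (simp only: rank_Y_def)
  then show ?thesis
    by (simp add: sum_4 power2_eq_square algebra_simps)
qed

lemma rank_Y_4_nonneg: "0 \<le> rank_Y \<sigma>" for \<sigma> :: "int ^ 4"
proof -
  let ?a = "\<sigma> $ 1" and ?b = "\<sigma> $ 2" and ?c = "\<sigma> $ 3" and ?d = "\<sigma> $ 4"
  have "rank_Y \<sigma> = (?a - ?b)\<^sup>2 + (?a - ?c)\<^sup>2 + (?a - ?d)\<^sup>2 + (?b - ?c)\<^sup>2 + (?b - ?d)\<^sup>2 + (?c - ?d)\<^sup>2"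
    by (simp add: rank_Y_4 sum_4 power2_eq_square algebra_simps)
  then show ?thesis by simp
qed

lemma gf_wf_r4: "gf_wf (r4_index s) rk"
  unfolding gf_wf_def
proof (intro conjI allI)
  show "rk ` r4_index s \<subseteq> \<nat>"
  proof (intro image_subsetI nonneg_in_Nats)
    fix \<sigma> :: "int ^ 4"
    have "- 1 < (real_of_int (rank_Y \<sigma>) - 3) / 8" using rank_Y_4_nonneg[of \<sigma>] by simp
    then show "0 \<le> rk \<sigma>" by (simp add: rk_def)
  qed
  fix n
  define b where "b = 8 * int n + 3 + s\<^sup>2"
  let ?S = "{\<sigma> \<in> r4_index s. rk \<sigma> = of_nat n}"
  let ?f = "\<lambda>\<sigma> :: int ^ 4. (\<sigma> $ 1, \<sigma> $ 2, \<sigma> $ 3, \<sigma> $ 4)"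
  have "?f ` ?S \<subseteq> {-b..b} \<times> {-b..b} \<times> {-b..b} \<times> {-b..b}"
  proof (rule image_subsetI)
    fix \<sigma> assume "\<sigma> \<in> ?S"
    then have a: "\<sigma> \<in> r4_index s" "rk \<sigma> = int n" by simp_all
    from a(2) have "\<lceil>(real_of_int (rank_Y \<sigma>) - 3) / 8\<rceil> = int n" by (simp add: rk_def)
    then have "(real_of_int (rank_Y \<sigma>) - 3) / 8 \<le> real_of_int (int n)" by linarith
    then have "real_of_int (rank_Y \<sigma>) \<le> real_of_int (8 * int n + 3)" by simp
    then have "rank_Y \<sigma> \<le> 8 * int n + 3" by (simp only: of_int_le_iff)
    moreover have "(\<Sum>i\<in>UNIV. \<sigma> $ i) = s" using a(1) by (simp add: r4_index_def)
    ultimately have le: "4 * (\<Sum>i\<in>UNIV. (\<sigma> $ i)\<^sup>2) \<le> b" by (simp add: rank_Y_4 b_def)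
    have "(\<sigma> $ k)\<^sup>2 \<le> (\<Sum>i\<in>UNIV. (\<sigma> $ i)\<^sup>2)" for k
      by (rule member_le_sum) auto
    moreover have "0 \<le> (\<Sum>i\<in>UNIV. (\<sigma> $ i)\<^sup>2)" by (rule sum_nonneg) simp
    then have "(\<Sum>i\<in>UNIV. (\<sigma> $ i)\<^sup>2) \<le> b" using le by linarith
    ultimately have "(\<sigma> $ k)\<^sup>2 \<le> b" for k by (rule order_trans)
    then have "\<sigma> $ k \<in> {-b..b}" for k by (rule sq_le_imp_interval)
    then show "?f \<sigma> \<in> {-b..b} \<times> {-b..b} \<times> {-b..b} \<times> {-b..b}" by (intro SigmaI)
  qed
  then have "finite (?f ` ?S)" using finite_subset by blast
  moreover have "inj_on ?f ?S" by (auto simp: inj_on_def vec_eq_iff forall_4)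
  ultimately show "finite ?S" using finite_imageD by blast
qed

lemma gf_wf_fcc_int: "gf_wf fcc_int (\<lambda>(x, y, z). x\<^sup>2 + y\<^sup>2 + z\<^sup>2)"
  unfolding gf_wf_def
proof (intro conjI allI)
  show "(\<lambda>(x, y, z). x\<^sup>2 + y\<^sup>2 + z\<^sup>2) ` fcc_int \<subseteq> \<nat>" by (auto intro!: nonneg_in_Nats)
  fix n
  let ?I = "{- int n..int n}"
  have "{v \<in> fcc_int. (case v of (x, y, z) \<Rightarrow> x\<^sup>2 + y\<^sup>2 + z\<^sup>2) = int n} \<subseteq> ?I \<times> ?I \<times> ?I"
  proof
    fix v assume "v \<in> {v \<in> fcc_int. (case v of (x, y, z) \<Rightarrow> x\<^sup>2 + y\<^sup>2 + z\<^sup>2) = int n}"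
    then obtain x y z where v: "v = (x, y, z)" and e: "x\<^sup>2 + y\<^sup>2 + z\<^sup>2 = int n"
      by (cases v) auto
    then have "x\<^sup>2 \<le> int n" "y\<^sup>2 \<le> int n" "z\<^sup>2 \<le> int n"
      using zero_le_power2[of x] zero_le_power2[of y] zero_le_power2[of z] by linarith+
    then have "x \<in> ?I" "y \<in> ?I" "z \<in> ?I" by (auto dest!: sq_le_imp_interval)
    then show "v \<in> ?I \<times> ?I \<times> ?I" unfolding v by (intro SigmaI)
  qed
  then show "finite {v \<in> fcc_int. (case v of (x, y, z) \<Rightarrow> x\<^sup>2 + y\<^sup>2 + z\<^sup>2) = int n}"
    using finite_subset by blast
qed

lemma norm_vector_3: "(norm (vector [of_int x, of_int y, of_int z] :: real ^ 3))\<^sup>2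
    = of_int (x\<^sup>2 + y\<^sup>2 + z\<^sup>2)"
  by (simp add: norm_vec_def L2_set_def sum_3 vector_3)

lemma gf_wf_fcc_lattice: "gf_wf fcc_lattice (\<lambda>v. (norm v)\<^sup>2)"
  unfolding gf_wf_def
proof (intro conjI allI)
  let ?e = "\<lambda>(x, y, z). vector [of_int x, of_int y, of_int z] :: real ^ 3"
  let ?w = "\<lambda>(x, y, z). x\<^sup>2 + y\<^sup>2 + z\<^sup>2 :: int"
  have w: "(norm (?e v))\<^sup>2 = of_int (?w v)" for v
    by (cases v) (simp only: prod.case norm_vector_3)
  show "(\<lambda>v. (norm v)\<^sup>2) ` fcc_lattice \<subseteq> \<nat>"
  proof clarify
    fix u assume "u \<in> fcc_lattice"
    then obtain v where v: "v \<in> fcc_int" "u = ?e v" unfolding fcc_lattice_def by blast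
    then have "?w v \<in> \<nat>" using gf_wf_fcc_int unfolding gf_wf_def by blast
    then obtain k where "?w v = int k" by (auto elim: Nats_cases)
    then show "(norm u)\<^sup>2 \<in> \<nat>" unfolding v w by simp
  qed
  fix n
  have "{u \<in> fcc_lattice. (norm u)\<^sup>2 = real n} \<subseteq> ?e ` {v \<in> fcc_int. ?w v = of_nat n}"
  proof clarify
    fix u assume "u \<in> fcc_lattice" and n: "(norm u)\<^sup>2 = real n"
    then obtain v where v: "v \<in> fcc_int" "u = ?e v" unfolding fcc_lattice_def by blast
    from n have "real_of_int (?w v) = real_of_int (int n)" unfolding v w by simp
    then have "?w v = int n" by (simp only: of_int_eq_iff)
    with v(1) show "u \<in> ?e ` {v \<in> fcc_int. ?w v = of_nat n}"
      unfolding v(2) by (intro imageI CollectI conjI)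
  qed
  moreover have "finite {v \<in> fcc_int. ?w v = of_nat n}"
    using gf_wf_fcc_int unfolding gf_wf_def by blast
  ultimately show "finite {u \<in> fcc_lattice. (norm u)\<^sup>2 = real n}"
    by (rule finite_subset[OF _ finite_imageI])
qed

lemma gf_wf_c2: "gf_wf {p. t_core 2 p} sum_list"
  unfolding gf_wf_def
proof (intro conjI allI)
  show "sum_list ` {p. t_core 2 p} \<subseteq> \<nat>" by (auto simp: Nats_def)
  fix n
  have "length p \<le> sum_list p" if "0 \<notin> set p" for p :: "nat list"
    using that by (induction p) auto
  then have "{p \<in> {p. t_core 2 p}. sum_list p = of_nat n} \<subseteq> {p. set p \<subseteq> {..n} \<and> length p \<le> n}"
    using member_le_sum_list by (fastforce simp: t_core_def is_partition_def)
  then show "finite {p \<in> {p. t_core 2 p}. sum_list p = of_nat n}"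
    using finite_lists_length_le[of "{..n}" n] finite_subset by blast
qed

end

theory Submission
  imports Defs "HOL-Computational_Algebra.Formal_Laurent_Series"
begin

text \<open>
  Both rank series are turned into weighted counts of points of the face-centred cubic lattice.
  For \<open>\<sigma>\<close> with coordinate sum \<open>s\<close>, the three numbers \<open>x\<close>, \<open>y\<close>, \<open>z\<close> given by
  \<open>\<sigma>\<^sub>1 + \<sigma>\<^sub>k - s\<close> for \<open>k = 2, 3, 4\<close> have even sum, every such triple arises exactly once
  (\<open>bij_betw_pair_sums\<close>), and for \<open>s \<in> {0, 1}\<close> the rank is half of
  \<open>x (x + s) + y (y + s) + z (z + s)\<close> (\<open>two_rk\<close>). So for \<open>s = 0\<close> twice the rank is the squared
  length of a lattice point, and for \<open>s = 1\<close> the rank is a sum of three triangular numbers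
  \<open>x (x + 1) / 2\<close> with integer, possibly negative, \<open>x\<close>.

  An even sum means that all three coordinates are even or exactly one of them is. Hence a weight
  that is the sum of one and the same function of each coordinate has generating function
  \<open>E\<^sup>3 + 3 E D\<^sup>2\<close>, where \<open>E\<close> and \<open>D\<close> are the one-variable series over the even and over the
  odd integers (\<open>gf_fcc_int\<close>). The reflection \<open>x \<mapsto> - 1 - x\<close> preserves triangular numbers, exchanges
  the parities and exchanges negative with nonnegative integers, so for \<open>s = 1\<close> both \<open>E\<close> and \<open>D\<close>
  are \<open>psi\<close>, and the series is \<open>4 psi\<^sup>3\<close>. For \<open>s = 0\<close> the squares of even and odd integers
  give \<open>phi(q\<^sup>4)\<close> and, since \<open>(2 m + 1)\<^sup>2\<close> is 1 plus eight times a triangular number,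
  \<open>2 q psi(q\<^sup>8)\<close>; this is the stated formula with \<open>q\<^sup>2\<close> in place of \<open>q\<close>.

  Finally, \<open>c2 = psi\<close> because the 2-cores are the staircases \<open>(k, k - 1, \<dots>, 1)\<close>
  (\<open>c2_eq_psi\<close>).
\<close>

(* The dollar sign is left to vector components. *)
no_notation fps_nth (infixl \<open>$\<close> 75)

section \<open>Generating functions of weighted sets\<close>

lemma gf_nth: "fps_nth (gf A w) n = int (card {x\<in>A. w x = of_nat n})"
  by (simp add: gf_def)

text \<open>
  The two weights may live in different semirings, so this also transports a natural-number
  weight to an integer or a real one.
\<close>

lemma gf_bij:
  assumes "bij_betw f A B" and "\<And>x n. x \<in> A \<Longrightarrow> w x = of_nat n \<longleftrightarrow> v (f x) = of_nat n"
  shows "gf A w = gf B v"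
proof (rule fps_ext)
  fix n
  have "bij_betw f {x\<in>A. w x = of_nat n} {y\<in>B. v y = of_nat n}"
    using assms unfolding bij_betw_def inj_on_def by blast
  then show "fps_nth (gf A w) n = fps_nth (gf B v) n"
    unfolding gf_nth by (simp add: bij_betw_same_card)
qed

lemma gf_cong: "(\<And>x. x \<in> A \<Longrightarrow> w x = v x) \<Longrightarrow> gf A w = gf A v"
  by (rule gf_bij[of id]) auto

lemma gf_wf_mono:
  assumes "gf_wf B w" "A \<subseteq> B"
  shows "gf_wf A w"
  unfolding gf_wf_def
proof (intro conjI allI)
  show "w ` A \<subseteq> \<nat>" using assms unfolding gf_wf_def by blast
  have "{x\<in>A. w x = of_nat n} \<subseteq> {x\<in>B. w x = of_nat n}" for n using assms(2) by blast
  then show "finite {x\<in>A. w x = of_nat n}" for n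
    using assms(1) unfolding gf_wf_def by (meson finite_subset)
qed

lemma gf_wfE:
  assumes "gf_wf A w" "x \<in> A"
  obtains n where "w x = of_nat n"
  using assms unfolding gf_wf_def by (metis Nats_cases image_subset_iff)

lemma gf_wf_finite: "gf_wf A w \<Longrightarrow> finite {x\<in>A. w x = of_nat n}"
  by (simp add: gf_wf_def)

lemma gf_Un_disjoint:
  assumes "gf_wf (A \<union> B) w" "A \<inter> B = {}"
  shows "gf (A \<union> B) w = gf A w + gf B w"
proof (rule fps_ext)
  fix n
  have "finite {x\<in>A. w x = of_nat n}" "finite {x\<in>B. w x = of_nat n}"
    using assms(1) by (auto intro: gf_wf_finite gf_wf_mono)
  moreover have "{x\<in>A \<union> B. w x = of_nat n} = {x\<in>A. w x = of_nat n} \<union> {x\<in>B. w x = of_nat n}"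
    by blast
  moreover have "{x\<in>A. w x = of_nat n} \<inter> {x\<in>B. w x = of_nat n} = {}"
    using assms(2) by blast
  ultimately show "fps_nth (gf (A \<union> B) w) n = fps_nth (gf A w + gf B w) n"
    by (simp add: gf_nth card_Un_disjoint)
qed

text \<open>
  The Cauchy product seen on sets: a pair has total weight \<open>n\<close> exactly when its components have
  weights \<open>i\<close> and \<open>n - i\<close> for one \<open>i \<le> n\<close>. Natural-number weights are essential, as otherwise
  the total could split in other ways.
\<close>

lemma weight_fibre_Times:
  assumes "gf_wf A w" "gf_wf B v"
  shows "{p\<in>A \<times> B. (case p of (x, y) \<Rightarrow> w x + v y) = of_nat n}
    = (\<Union>i\<in>{0..n}. {x\<in>A. w x = of_nat i} \<times> {y\<in>B. v y = of_nat (n - i)})" (is "?L = ?R")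
proof
  show "?L \<subseteq> ?R"
  proof clarify
    fix x y assume xy: "x \<in> A" "y \<in> B" "w x + v y = of_nat n"
    obtain i j where "w x = of_nat i" "v y = of_nat j"
      using xy(1,2) assms by (meson gf_wfE)
    with xy show "(x, y) \<in> ?R"
      by (auto simp flip: of_nat_add intro!: bexI[of _ i])
  qed
  show "?R \<subseteq> ?L" by (auto simp flip: of_nat_add)
qed

lemma gf_wf_Times:
  assumes "gf_wf A w" "gf_wf B v"
  shows "gf_wf (A \<times> B) (\<lambda>(x, y). w x + v y)"
  unfolding gf_wf_def
proof (intro conjI allI)
  show "(\<lambda>(x, y). w x + v y) ` (A \<times> B) \<subseteq> \<nat>"
    using assms unfolding gf_wf_def by (auto intro!: Nats_add)
  show "finite {p\<in>A \<times> B. (case p of (x, y) \<Rightarrow> w x + v y) = of_nat n}" for n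
    unfolding weight_fibre_Times[OF assms]
    by (intro finite_UN_I finite_cartesian_product gf_wf_finite[OF assms(1)]
        gf_wf_finite[OF assms(2)]) simp
qed

lemma gf_Times:
  assumes "gf_wf A w" "gf_wf B v"
  shows "gf (A \<times> B) (\<lambda>(x, y). w x + v y) = gf A w * gf B v"
proof (rule fps_ext)
  fix n
  have "card {p\<in>A \<times> B. (case p of (x, y) \<Rightarrow> w x + v y) = of_nat n}
      = (\<Sum>i\<in>{0..n}. card ({x\<in>A. w x = of_nat i} \<times> {y\<in>B. v y = of_nat (n - i)}))"
    unfolding weight_fibre_Times[OF assms]
    by (intro card_UN_disjoint)
       (auto intro!: finite_cartesian_product gf_wf_finite[OF assms(1)] gf_wf_finite[OF assms(2)])
  then show "fps_nth (gf (A \<times> B) (\<lambda>(x, y). w x + v y)) n = fps_nth (gf A w * gf B v) n"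
    by (simp add: gf_nth fps_mult_nth card_cartesian_product)
qed

lemma gf_Times3:
  assumes "gf_wf A u" "gf_wf B v" "gf_wf C w"
  shows "gf (A \<times> B \<times> C) (\<lambda>(x, y, z). u x + v y + w z) = gf A u * gf B v * gf C w"
proof -
  have "gf (A \<times> B \<times> C) (\<lambda>(x, y, z). u x + v y + w z)
      = gf (A \<times> (B \<times> C)) (\<lambda>(x, p). u x + (case p of (y, z) \<Rightarrow> v y + w z))"
    by (rule gf_cong) (auto simp: add.assoc)
  also have "\<dots> = gf A u * (gf B v * gf C w)"
    by (simp only: gf_Times[OF assms(1) gf_wf_Times[OF assms(2,3)]] gf_Times[OF assms(2,3)])
  finally show ?thesis by (simp add: mult.assoc)
qed

lemma gf_wf_Times3:
  assumes "gf_wf A u" "gf_wf B v" "gf_wf C w"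
  shows "gf_wf (A \<times> B \<times> C) (\<lambda>(x, y, z). u x + v y + w z)"
proof -
  have "(\<lambda>(x, y, z). u x + v y + w z) = (\<lambda>(x, p). u x + (case p of (y, z) \<Rightarrow> v y + w z))"
    by (auto simp: add.assoc)
  then show ?thesis
    using gf_wf_Times[OF assms(1) gf_wf_Times[OF assms(2,3)]] by simp
qed

lemma weight_fibre_of_nat_mult:
  assumes "gf_wf A w" "k > 0"
  shows "{x\<in>A. of_nat k * w x = of_nat n} = {x\<in>A. k dvd n \<and> w x = of_nat (n div k)}"
proof -
  have "of_nat k * w x = of_nat n \<longleftrightarrow> k dvd n \<and> w x = of_nat (n div k)" if "x \<in> A" for x
  proof -
    obtain i where "w x = of_nat i" using assms(1) \<open>x \<in> A\<close> by (rule gf_wfE)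
    then show ?thesis using assms(2) by (auto simp flip: of_nat_mult)
  qed
  then show ?thesis by blast
qed

lemma gf_wf_of_nat_mult:
  assumes "gf_wf A w" "k > 0"
  shows "gf_wf A (\<lambda>x. of_nat k * w x)"
  unfolding gf_wf_def
proof (intro conjI allI)
  show "(\<lambda>x. of_nat k * w x) ` A \<subseteq> \<nat>"
    using assms(1) unfolding gf_wf_def by (auto intro!: Nats_mult)
  show "finite {x\<in>A. of_nat k * w x = of_nat n}" for n
    unfolding weight_fibre_of_nat_mult[OF assms]
    by (auto intro: finite_subset[OF _ gf_wf_finite[OF assms(1), of "n div k"]])
qed

lemma gf_compose_X_power:
  assumes "gf_wf A w" "k > 0"
  shows "gf A w oo fps_X ^ k = gf A (\<lambda>x. of_nat k * w x)"
proof (rule fps_ext)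
  fix n
  show "fps_nth (gf A w oo fps_X ^ k) n = fps_nth (gf A (\<lambda>x. of_nat k * w x)) n"
    by (simp add: gf_nth weight_fibre_of_nat_mult[OF assms] fps_nth_compose_X_power)
qed

lemma gf_Suc_weight:
  assumes "gf_wf A w"
  shows "gf A (\<lambda>x. w x + 1) = fps_X * gf A w"
proof (rule fps_ext)
  fix n
  have "w x + 1 = of_nat n \<longleftrightarrow> n \<noteq> 0 \<and> w x = of_nat (n - 1)" if "x \<in> A" for x
  proof -
    obtain i where "w x = of_nat i" using assms \<open>x \<in> A\<close> by (rule gf_wfE)
    then have "w x + 1 = of_nat n \<longleftrightarrow> Suc i = n" "w x = of_nat (n - 1) \<longleftrightarrow> i = n - 1"
      by (simp_all add: add.commute flip: of_nat_Suc)
    then show ?thesis by auto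
  qed
  then have "{x\<in>A. w x + 1 = of_nat n} = (if n = 0 then {} else {x\<in>A. w x = of_nat (n - 1)})"
    by auto
  then show "fps_nth (gf A (\<lambda>x. w x + 1)) n = fps_nth (fps_X * gf A w) n"
    by (simp add: gf_nth)
qed

text \<open>
  Used to cancel the substitution \<open>q \<mapsto> q\<^sup>2\<close> at the end of the proof of the formula for \<open>r4 0\<close>.
\<close>

lemma fps_compose_X_power_inj:
  fixes F G :: "int fps"
  assumes "F oo fps_X ^ k = G oo fps_X ^ k" "k > 0"
  shows "F = G"
proof -
  have "(F - G) oo fps_X ^ k = 0" using assms(1) by (simp add: fps_compose_sub_distrib)
  then show ?thesis using assms(2) by (simp add: fps_compose_eq_0_iff)
qed

lemma fps_compose_X_power_X_power:
  fixes F :: "int fps"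
  assumes "m > 0" "n > 0"
  shows "(F oo fps_X ^ m) oo fps_X ^ n = F oo fps_X ^ (m * n)"
  using assms
  by (simp add: power_mult mult.commute[of m] fps_X_power_compose flip: fps_compose_assoc)

section \<open>The face-centred cubic lattice\<close>

text \<open>
  Split the lattice by the parity pattern of a point: even-even-even, or an even coordinate in one
  of three positions and two odd ones. Each piece is a product set.
\<close>

lemma gf_fcc_int:
  assumes "gf_wf UNIV w"
  defines "E \<equiv> gf {x. even x} w" and "D \<equiv> gf {x. odd x} w"
  shows "gf fcc_int (\<lambda>(x, y, z). w x + w y + w z) = E ^ 3 + 3 * E * D ^ 2"
proof -
  let ?e = "{x::int. even x}" and ?o = "{x::int. odd x}"
  let ?w = "\<lambda>(x, y, z). w x + w y + w z"
  have wf: "gf_wf ?e w" "gf_wf ?o w" using assms(1) by (auto intro: gf_wf_mono)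
  have all: "gf_wf A ?w" for A
    using gf_wf_mono[OF gf_wf_Times3[OF assms(1,1,1)]] by simp
  have parts: "fcc_int = ?e \<times> ?e \<times> ?e \<union> (?e \<times> ?o \<times> ?o \<union> (?o \<times> ?e \<times> ?o \<union> ?o \<times> ?o \<times> ?e))"
    unfolding fcc_int_def by auto
  have "gf fcc_int ?w = gf (?e \<times> ?e \<times> ?e) ?w
      + (gf (?e \<times> ?o \<times> ?o) ?w + (gf (?o \<times> ?e \<times> ?o) ?w + gf (?o \<times> ?o \<times> ?e) ?w))"
    unfolding parts by (subst gf_Un_disjoint[OF all], blast)+ (rule refl)
  moreover have "gf (?e \<times> ?e \<times> ?e) ?w = E * E * E"
    unfolding E_def by (rule gf_Times3[OF wf(1,1,1)])
  moreover have "gf (?e \<times> ?o \<times> ?o) ?w = E * D * D"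
    unfolding E_def D_def by (rule gf_Times3[OF wf(1,2,2)])
  moreover have "gf (?o \<times> ?e \<times> ?o) ?w = D * E * D"
    unfolding E_def D_def by (rule gf_Times3[OF wf(2,1,2)])
  moreover have "gf (?o \<times> ?o \<times> ?e) ?w = D * D * E"
    unfolding E_def D_def by (rule gf_Times3[OF wf(2,2,1)])
  moreover have "E * E * E + (E * D * D + (D * E * D + D * D * E)) = E ^ 3 + 3 * E * D ^ 2"
    by (simp add: power2_eq_square power3_eq_cube algebra_simps)
  ultimately show ?thesis by (simp only:)
qed

text \<open>
  Triangular numbers indexed by all integers: each one is attained twice, at \<open>t\<close> and at \<open>- 1 - t\<close>.
\<close>

definition tri :: "int \<Rightarrow> int" where
  "tri x = x * (x + 1) div 2"

lemma two_tri: "2 * tri x = x * (x + 1)"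
  unfolding tri_def by simp

lemma tri_reflect: "tri (- 1 - x) = tri x"
  unfolding tri_def by (simp add: algebra_simps)

lemma tri_of_nat: "tri (int t) = int (t * (t + 1) div 2)"
  unfolding tri_def by (simp add: zdiv_int algebra_simps)

lemma gf_wf_tri: "gf_wf UNIV tri"
  unfolding gf_wf_def
proof (intro conjI allI)
  have "0 \<le> tri x" for x
    using two_tri[of x] zero_le_mult_iff[of x "x + 1"] by linarith
  then show "range tri \<subseteq> \<nat>" by (auto intro: nonneg_in_Nats)
  fix n
  have "x \<in> {- (8 * int n + 1)..8 * int n + 1}" if "tri x = int n" for x
  proof -
    have "(2 * x + 1)\<^sup>2 = 8 * tri x + 1"
      using two_tri[of x] by (simp add: power2_eq_square algebra_simps)
    then have "2 * x + 1 \<in> {- (8 * int n + 1)..8 * int n + 1}"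
      using that by (intro sq_le_imp_interval) simp
    then show ?thesis by simp
  qed
  then show "finite {x\<in>UNIV. tri x = of_nat n}"
    by (auto intro: finite_subset[of _ "{- (8 * int n + 1)..8 * int n + 1}"])
qed

text \<open>
  Of the two integers \<open>t\<close> and \<open>- 1 - t\<close> with the same triangular number, exactly one has the
  prescribed parity.
\<close>

lemma gf_tri_parity: "gf {x. even x = b} tri = psi"
proof -
  let ?f = "\<lambda>t. if even t = b then int t else - 1 - int t"
  let ?g = "\<lambda>x. nat (if x \<ge> 0 then x else - 1 - x)"
  have "bij_betw ?f UNIV {x. even x = b}"
    by (rule bij_betw_byWitness[where f' = ?g]) (auto simp: even_nat_iff)
  moreover have "tri (?f t) = int (t * (t + 1) div 2)" for t
    by (simp only: tri_reflect tri_of_nat if_distrib[of tri] if_cancel)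
  ultimately have "psi = gf {x. even x = b} tri"
    unfolding psi_def by (intro gf_bij[of ?f]) (simp_all only: of_nat_eq_iff of_nat_id)
  then show ?thesis by simp
qed

lemma gf_tri_even: "gf {x. even x} tri = psi" and gf_tri_odd: "gf {x. odd x} tri = psi"
  using gf_tri_parity[of True] gf_tri_parity[of False] by simp_all

lemma gf_tri_UNIV: "gf UNIV tri = 2 * psi"
proof -
  have U: "UNIV = {x::int. even x} \<union> {x. odd x}" by blast
  have "gf UNIV tri = gf {x. even x} tri + gf {x. odd x} tri"
    unfolding U by (rule gf_Un_disjoint) (use gf_wf_tri U in auto)
  then show ?thesis by (simp add: gf_tri_even gf_tri_odd)
qed

lemma gf_square_even: "gf {x::int. even x} (\<lambda>x. x\<^sup>2) = phi oo fps_X ^ 4"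
proof -
  have "bij_betw (\<lambda>m::int. 2 * m) UNIV {x. even x}"
    by (rule bij_betw_byWitness[where f' = "\<lambda>x. x div 2"]) auto
  then have "gf UNIV (\<lambda>m::int. of_nat 4 * m\<^sup>2) = gf {x::int. even x} (\<lambda>x. x\<^sup>2)"
    by (rule gf_bij) (simp add: power2_eq_square)
  then show ?thesis
    unfolding phi_def by (simp only: gf_compose_X_power[OF gf_wf_phi, of 4] zero_less_numeral)
qed

lemma gf_square_odd: "gf {x::int. odd x} (\<lambda>x. x\<^sup>2) = 2 * fps_X * (psi oo fps_X ^ 8)"
proof -
  have "bij_betw (\<lambda>m::int. 2 * m + 1) UNIV {x. odd x}"
    by (rule bij_betw_byWitness[where f' = "\<lambda>x. x div 2"]) auto
  moreover have "of_nat 8 * tri m + 1 = (2 * m + 1)\<^sup>2" for m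
    using two_tri[of m] by (simp add: power2_eq_square algebra_simps)
  ultimately have "gf {x::int. odd x} (\<lambda>x. x\<^sup>2) = gf UNIV (\<lambda>m. of_nat 8 * tri m + 1)"
    by (intro gf_bij[symmetric]) simp_all
  also have "\<dots> = fps_X * (gf UNIV tri oo fps_X ^ 8)"
    by (simp only: gf_Suc_weight gf_wf_of_nat_mult gf_compose_X_power gf_wf_tri zero_less_numeral)
  also have "gf UNIV tri oo fps_X ^ 8 = 2 * (psi oo fps_X ^ 8)"
    by (simp add: gf_tri_UNIV fps_compose_mult_distrib)
  finally show ?thesis by (simp add: algebra_simps)
qed

section \<open>From rank to the face-centred cubic lattice\<close>

lemma vector_4:
  "(vector [a, b, c, d] :: 'a::zero ^ 4) $ 1 = a"
  "(vector [a, b, c, d] :: 'a::zero ^ 4) $ 2 = b"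
  "(vector [a, b, c, d] :: 'a::zero ^ 4) $ 3 = c"
  "(vector [a, b, c, d] :: 'a::zero ^ 4) $ 4 = d"
  unfolding vector_def by simp_all

text \<open>
  For \<open>s = 0\<close> this is the classical isometry from the root lattice \<open>A\<^sub>3\<close> onto \<open>D\<^sub>3\<close>, which is the
  face-centred cubic lattice. The shift by \<open>s\<close> keeps the image inside \<open>D\<^sub>3\<close> for
  every \<open>s\<close>: the sum of the entries is \<open>2 (\<sigma>\<^sub>1 - s)\<close>,
  which also recovers \<open>\<sigma>\<^sub>1\<close>.
\<close>

definition pair_sums :: "int \<Rightarrow> int ^ 4 \<Rightarrow> int \<times> int \<times> int" where
  "pair_sums s \<sigma> = (\<sigma> $ 1 + \<sigma> $ 2 - s, \<sigma> $ 1 + \<sigma> $ 3 - s, \<sigma> $ 1 + \<sigma> $ 4 - s)"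

lemma bij_betw_pair_sums: "bij_betw (pair_sums s) (r4_index s) fcc_int"
proof (rule bij_betw_byWitness)
  have sum_eq: "(\<sigma> $ 1 + \<sigma> $ 2 - s) + (\<sigma> $ 1 + \<sigma> $ 3 - s) + (\<sigma> $ 1 + \<sigma> $ 4 - s) = 2 * (\<sigma> $ 1 - s)"
    if "\<sigma> \<in> r4_index s" for \<sigma>
    using that by (simp add: r4_index_def sum_4)
  let ?g = "\<lambda>(x, y, z). let a = (x + y + z) div 2 + s in
    vector [a, x + s - a, y + s - a, z + s - a] :: int ^ 4"
  show "\<forall>\<sigma>\<in>r4_index s. ?g (pair_sums s \<sigma>) = \<sigma>"
  proof
    fix \<sigma> assume "\<sigma> \<in> r4_index s"
    then have "?g (pair_sums s \<sigma>) = (let a = 2 * (\<sigma> $ 1 - s) div 2 + s in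
        vector [a, \<sigma> $ 1 + \<sigma> $ 2 - a, \<sigma> $ 1 + \<sigma> $ 3 - a, \<sigma> $ 1 + \<sigma> $ 4 - a])"
      by (simp only: pair_sums_def prod.case sum_eq diff_add_cancel)
    then show "?g (pair_sums s \<sigma>) = \<sigma>"
      by (simp add: vec_eq_iff forall_4 vector_4 Let_def)
  qed
  show "\<forall>p\<in>fcc_int. pair_sums s (?g p) = p"
    by (auto simp: pair_sums_def vector_4 Let_def)
  show "pair_sums s ` r4_index s \<subseteq> fcc_int"
    by (auto simp only: pair_sums_def fcc_int_def mem_Collect_eq prod.case sum_eq dvd_triv_left)
  show "?g ` fcc_int \<subseteq> r4_index s"
  proof (rule image_subsetI, clarify)
    fix x y z assume "(x, y, z) \<in> fcc_int"
    then obtain k where k: "x + y + z = 2 * k"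
      unfolding fcc_int_def by (auto simp del: even_add elim: evenE)
    then have "(x + y + z) div 2 = k" by simp
    with k show "(let a = (x + y + z) div 2 + s in
        vector [a, x + s - a, y + s - a, z + s - a]) \<in> r4_index s"
      by (simp add: r4_index_def sum_4 vector_4 Let_def)
  qed
qed

text \<open>
  With \<open>Q\<close> the quadratic expression on the right, \<open>rank_Y \<sigma> = 4 Q + 3 s\<^sup>2\<close>, and \<open>Q\<close> is even:
  for \<open>s = 0\<close> because \<open>x + y + z\<close> is, for \<open>s = 1\<close> because each \<open>x (x + 1)\<close> is. The argument
  of the ceiling is therefore the integer \<open>Q / 2\<close> plus \<open>(3 s\<^sup>2 - 3) / 8\<close>, and for
  \<open>s \<in> {0, 1}\<close> this correction lies in \<open>(- 1, 0]\<close>.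
\<close>

lemma two_rk:
  assumes "\<sigma> \<in> r4_index s" "s \<in> {0, 1}"
  shows "2 * rk \<sigma> = (case pair_sums s \<sigma> of (x, y, z) \<Rightarrow> x * (x + s) + y * (y + s) + z * (z + s))"
    (is "_ = ?q")
proof -
  have s: "s = \<sigma> $ 1 + \<sigma> $ 2 + \<sigma> $ 3 + \<sigma> $ 4"
    using assms(1) by (simp add: r4_index_def sum_4)
  have Y: "rank_Y \<sigma> = 4 * ?q + 3 * s\<^sup>2"
    unfolding rank_Y_4 pair_sums_def s by (simp add: sum_4 power2_eq_square algebra_simps)
  have "even (x * (x + s))" if "s = 1" for x :: int using that by simp
  moreover have "pair_sums s \<sigma> \<in> fcc_int"
    using bij_betw_pair_sums assms(1) by (rule bij_betwE[THEN bspec])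
  ultimately have "even ?q"
    using assms(2) by (auto simp: fcc_int_def split: prod.splits)
  then obtain m where m: "?q = 2 * m" by (elim evenE)
  have "rk \<sigma> = \<lceil>real_of_int m + (3 * (real_of_int s)\<^sup>2 - 3) / 8\<rceil>"
    unfolding rk_def Y m by (simp add: field_simps)
  also have "\<dots> = m"
    using assms(2) by (auto intro!: ceiling_unique)
  finally show ?thesis by (simp add: m)
qed

lemma r4_0_compose:
  "r4 0 oo fps_X ^ 2 = gf fcc_int (\<lambda>(x, y, z). x\<^sup>2 + y\<^sup>2 + z\<^sup>2)"
proof -
  have "r4 0 oo fps_X ^ 2 = gf (r4_index 0) (\<lambda>\<sigma>. of_nat 2 * rk \<sigma>)"
    unfolding r4_def by (rule gf_compose_X_power[OF gf_wf_r4]) simp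
  also have "\<dots> = gf fcc_int (\<lambda>(x, y, z). x\<^sup>2 + y\<^sup>2 + z\<^sup>2)"
    by (rule gf_bij[OF bij_betw_pair_sums])
       (use two_rk in \<open>auto simp: power2_eq_square split: prod.splits\<close>)
  finally show ?thesis .
qed

lemma r4_1_eq: "r4 1 = 4 * psi ^ 3"
proof -
  have "r4 1 = gf fcc_int (\<lambda>(x, y, z). tri x + tri y + tri z)"
    unfolding r4_def
  proof (rule gf_bij[OF bij_betw_pair_sums])
    fix \<sigma> n assume "\<sigma> \<in> r4_index 1"
    then have "2 * rk \<sigma> = 2 * (case pair_sums 1 \<sigma> of (x, y, z) \<Rightarrow> tri x + tri y + tri z)"
      using two_rk[of \<sigma> 1] by (simp add: distrib_left two_tri split: prod.splits)
    then show "rk \<sigma> = of_nat n \<longleftrightarrow>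
        (case pair_sums 1 \<sigma> of (x, y, z) \<Rightarrow> tri x + tri y + tri z) = of_nat n"
      by simp
  qed
  also have "\<dots> = psi ^ 3 + 3 * psi * psi ^ 2"
    by (simp only: gf_fcc_int[OF gf_wf_tri] gf_tri_even gf_tri_odd)
  also have "\<dots> = 4 * psi ^ 3"
    by (simp add: power2_eq_square power3_eq_cube algebra_simps)
  finally show ?thesis .
qed

lemma r4_0_eq:
  "r4 0 = (phi oo fps_X ^ 2) ^ 3 + 12 * fps_X * (phi oo fps_X ^ 2) * (psi oo fps_X ^ 4) ^ 2"
    (is "_ = ?rhs")
proof (rule fps_compose_X_power_inj)
  have "r4 0 oo fps_X ^ 2 = (phi oo fps_X ^ 4) ^ 3
      + 3 * (phi oo fps_X ^ 4) * (2 * fps_X * (psi oo fps_X ^ 8)) ^ 2"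
    by (simp only: r4_0_compose gf_fcc_int[OF gf_wf_phi] gf_square_even gf_square_odd)
  also have "\<dots> = (phi oo fps_X ^ 4) ^ 3
      + 12 * fps_X ^ 2 * (phi oo fps_X ^ 4) * (psi oo fps_X ^ 8) ^ 2"
    by (simp add: power2_eq_square algebra_simps)
  also have "\<dots> = ?rhs oo fps_X ^ 2"
    by (simp add: fps_compose_add_distrib fps_compose_mult_distrib fps_compose_X_power_X_power
        flip: fps_compose_power)
  finally show "r4 0 oo fps_X ^ 2 = ?rhs oo fps_X ^ 2" .
qed simp

lemma theta_series_fcc_lattice:
  "theta_series fcc_lattice = gf fcc_int (\<lambda>(x, y, z). x\<^sup>2 + y\<^sup>2 + z\<^sup>2)"
proof -
  let ?e = "\<lambda>(x, y, z). vector [of_int x, of_int y, of_int z] :: real ^ 3"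
  have "inj_on ?e fcc_int" by (auto simp: inj_on_def vec_eq_iff forall_3)
  then have "bij_betw ?e fcc_int fcc_lattice"
    by (simp only: bij_betw_def fcc_lattice_def)
  then show ?thesis
    unfolding theta_series_def
  proof (rule gf_bij[symmetric], clarify)
    fix x y z n
    have "(norm (vector [of_int x, of_int y, of_int z] :: real ^ 3))\<^sup>2 = of_nat n
        \<longleftrightarrow> real_of_int (x\<^sup>2 + y\<^sup>2 + z\<^sup>2) = real_of_int (of_nat n)"
      by (simp only: norm_vector_3 of_int_of_nat_eq)
    then show "x\<^sup>2 + y\<^sup>2 + z\<^sup>2 = of_nat n \<longleftrightarrow>
        (norm (vector [of_int x, of_int y, of_int z] :: real ^ 3))\<^sup>2 = of_nat n"
      by (simp only: of_int_eq_iff)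
  qed
qed

lemma r4_0_nth: "fps_nth (r4 0) n = int (card {v \<in> fcc_lattice. dist v 0 = sqrt (2 * real n)})"
proof -
  have "fps_nth (r4 0) n = fps_nth (r4 0 oo fps_X ^ 2) (2 * n)"
    by (simp add: fps_nth_compose_X_power)
  also have "\<dots> = fps_nth (theta_series fcc_lattice) (2 * n)"
    by (simp only: r4_0_compose theta_series_fcc_lattice)
  also have "\<dots> = int (card {v \<in> fcc_lattice. dist v 0 = sqrt (2 * real n)})"
  proof -
    have "(norm v)\<^sup>2 = of_nat (2 * n) \<longleftrightarrow> dist v 0 = sqrt (2 * real n)" for v :: "real ^ 3"
      by (auto simp: real_sqrt_unique)
    then show ?thesis unfolding theta_series_def gf_nth by simp
  qed
  finally show ?thesis .
qed

section \<open>Sums of three triangular numbers\<close>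

lemma gf_triangular: "gf triangular id = psi"
proof -
  have "strict_mono (\<lambda>t::nat. t * (t + 1) div 2)"
    unfolding strict_mono_Suc_iff
  proof
    fix t :: nat
    have "Suc t * (Suc t + 1) = t * (t + 1) + 2 * (t + 1)" by simp
    then have "Suc t * (Suc t + 1) div 2 = t * (t + 1) div 2 + (t + 1)"
      by (simp only: div_mult_self2[of 2] zero_neq_numeral not_False_eq_True)
    then show "t * (t + 1) div 2 < Suc t * (Suc t + 1) div 2" by simp
  qed
  then have "bij_betw (\<lambda>t::nat. t * (t + 1) div 2) UNIV triangular"
    unfolding triangular_def bij_betw_def by (auto simp: strict_mono_imp_inj_on)
  then show ?thesis
    unfolding psi_def by (intro gf_bij[symmetric]) auto
qed

lemma psi_cube_nth:
  "fps_nth (psi ^ 3) n =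
    int (card {(a, b, c). a \<in> triangular \<and> b \<in> triangular \<and> c \<in> triangular \<and> a + b + c = n})"
proof -
  have wf: "gf_wf triangular (id :: nat \<Rightarrow> nat)"
    by (auto simp: gf_wf_def Nats_def)
  have "psi ^ 3 = gf (triangular \<times> triangular \<times> triangular) (\<lambda>(a, b, c). id a + id b + id c)"
    unfolding gf_Times3[OF wf wf wf] gf_triangular by (simp add: power3_eq_cube)
  moreover have "{p \<in> triangular \<times> triangular \<times> triangular.
        (case p of (a, b, c) \<Rightarrow> id a + id b + id c) = of_nat n}
      = {(a, b, c). a \<in> triangular \<and> b \<in> triangular \<and> c \<in> triangular \<and> a + b + c = n}"
    by auto
  ultimately show ?thesis by (simp only: gf_nth)
qed

section \<open>Two-cores are staircases\<close>

text \<open>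
  Padding with zeros makes a partition an antitone sequence, so that removing cells is a pointwise
  update and no case distinction at the last row is needed.
\<close>

definition row_length :: "nat list \<Rightarrow> nat \<Rightarrow> nat" where
  "row_length p i = (if i < length p then p ! i else 0)"

lemma mem_young_diagram_iff: "(i, j) \<in> young_diagram p \<longleftrightarrow> j < row_length p i"
  by (simp add: young_diagram_def row_length_def)

lemma row_length_pos_iff:
  assumes "is_partition p"
  shows "0 < row_length p i \<longleftrightarrow> i < length p"
  using assms nth_mem[of i p] unfolding is_partition_def row_length_def by (metis gr0I less_irrefl)

lemma antimono_row_length:
  assumes "is_partition p"
  shows "antimono (row_length p)"
proof (rule antimonoI)
  fix i i' :: nat assume "i \<le> i'"
  then show "row_length p i' \<le> row_length p i"
    using assms unfolding is_partition_def row_length_def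
    by (cases "i = i'") (auto simp: sorted_wrt_iff_nth_less)
qed

lemma young_diagram_down_closed:
  assumes "is_partition p" "(i, j) \<in> young_diagram p" "i' \<le> i" "j' \<le> j"
  shows "(i', j') \<in> young_diagram p"
  using assms antimonoD[OF antimono_row_length[OF assms(1)] assms(3)]
  by (simp add: mem_young_diagram_iff)

lemma partition_of_row_lengths:
  fixes f :: "nat \<Rightarrow> nat"
  assumes "antimono f" "f n = 0"
  obtains p where "is_partition p" "young_diagram p = {(i, j). j < f i}"
proof
  define k where "k = (LEAST k. f k = 0)"
  have "f k = 0" unfolding k_def using assms(2) by (rule LeastI)
  have pos: "0 < f i \<longleftrightarrow> i < k" for i
  proof
    show "0 < f i" if "i < k" using not_less_Least[of i "\<lambda>k. f k = 0"] that k_def by auto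
    show "i < k" if "0 < f i"
      using antimonoD[OF assms(1), of k i] \<open>f k = 0\<close> that by (cases "i < k") auto
  qed
  let ?p = "map f [0..<k]"
  show "is_partition ?p"
    unfolding is_partition_def
  proof
    show "sorted_wrt (\<ge>) ?p"
      using antimonoD[OF assms(1)] by (auto simp: sorted_wrt_iff_nth_less)
    show "0 \<notin> set ?p" using pos by (metis atLeastLessThan_iff imageE less_irrefl set_map set_upt)
  qed
  have "j < f i \<Longrightarrow> i < k" for i j using pos[of i] by simp
  then show "young_diagram ?p = {(i, j). j < f i}"
    by (auto simp: young_diagram_def)
qed

lemma domino_cells_connected:
  assumes "(a, b) \<in> cell_adj"
  shows "cells_connected {a, b}"
proof -
  have "(b, a) \<in> cell_adj" using assms by (auto simp: cell_adj_def)
  with assms show ?thesis unfolding cells_connected_def by blast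
qed

lemma cells_connected_card_2E:
  assumes "cells_connected R" "card R = 2"
  obtains a b where "R = {a, b}" "(a, b) \<in> cell_adj"
proof -
  obtain a b where R: "R = {a, b}" "a \<noteq> b" using assms(2) by (auto simp: card_2_iff)
  then have "(a, b) \<in> (cell_adj \<inter> R \<times> R)\<^sup>*"
    using assms(1) unfolding cells_connected_def by blast
  then obtain c where "(a, c) \<in> cell_adj \<inter> R \<times> R"
    using \<open>a \<noteq> b\<close> by (meson converse_rtranclE)
  moreover have "(a, a) \<notin> cell_adj" by (cases a) (simp add: cell_adj_def)
  ultimately have "(a, b) \<in> cell_adj" using R by auto
  with R that show thesis by blast
qed

lemma cell_adj_orderedE:
  assumes "(a, b) \<in> cell_adj"
  obtains i j where "{a, b} = {(i, j), (i, Suc j)}" | i j where "{a, b} = {(i, j), (Suc i, j)}"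
proof -
  obtain i j i' j' where ab: "a = (i, j)" "b = (i', j')" by (cases a; cases b) blast
  then consider "i = i'" "j = Suc j'" | "i = i'" "j' = Suc j" | "j = j'" "i = Suc i'" | "j = j'" "i' = Suc i"
    using assms unfolding cell_adj_def by blast
  then show thesis
  proof cases
    case 1
    then show thesis using that(1)[of i j'] by (simp add: ab insert_commute)
  next
    case 2
    then show thesis using that(1)[of i j] by (simp add: ab)
  next
    case 3
    then show thesis using that(2)[of i' j] by (simp add: ab insert_commute)
  next
    case 4
    then show thesis using that(2)[of i j] by (simp add: ab)
  qed
qed

text \<open>
  A set of two adjacent cells is connected and too small to contain a square block, so only the
  shape left after its removal matters.
\<close>

lemma removable_domino:
  assumes "is_partition p" "is_partition p'" "(a, b) \<in> cell_adj"
    and "{a, b} \<subseteq> young_diagram p" "young_diagram p' = young_diagram p - {a, b}"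
  shows "\<not> t_core 2 p"
proof -
  have "a \<noteq> b" using assms(3) by (auto simp: cell_adj_def)
  then have "card {a, b} = 2" by simp
  moreover have "no_2x2_block {a, b}" unfolding no_2x2_block_def by auto
  ultimately have "removable_rim_hook p 2 {a, b}"
    using assms domino_cells_connected unfolding removable_rim_hook_def by blast
  then show ?thesis unfolding t_core_def by blast
qed

text \<open>
  The least index at which \<open>f\<close> drops below \<open>f i\<close> ends the block of values equal to \<open>f i\<close>; the pair
  sits at the two indices just before it.
\<close>

lemma antimono_last_equal_pair:
  fixes f :: "nat \<Rightarrow> nat"
  assumes "antimono f" "f n = 0" "0 < f i" "f (Suc i) = f i"
  obtains l where "f l = f i" "f (Suc l) = f i" "f (Suc (Suc l)) < f i"
proof -
  define m where "m = (LEAST m. f m < f i)"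
  have m: "f m < f i"
    unfolding m_def by (rule LeastI[of _ n]) (use assms(2,3) in simp)
  have before_m: "f i \<le> f k" if "k < m" for k
    using not_less_Least[of k "\<lambda>m. f m < f i"] that unfolding m_def by simp
  have "Suc i < m"
    using antimonoD[OF assms(1), of m "Suc i"] m assms(4) by (cases "Suc i < m") simp_all
  then obtain l where l: "m = Suc (Suc l)" "i \<le> l"
    using that[of "m - 2"] by simp
  have "f l \<le> f i" "f (Suc l) \<le> f i"
    using l(2) by (simp_all only: antimonoD[OF assms(1)] le_SucI)
  then show thesis
    using before_m[of l] before_m[of "Suc l"] m l(1) by (intro that[of l]) simp_all
qed

text \<open>
  If a row exceeds the next one by at least two, its last two cells form a removable horizontal
  domino. If two consecutive nonempty rows are equal, the last two rows of that length end in a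
  removable vertical domino. In a 2-core neither happens, so each row is exactly one longer than
  the next.
\<close>

lemma t_core_2_row_diff:
  assumes "t_core 2 p" "i < length p"
  shows "row_length p i = Suc (row_length p (Suc i))"
proof -
  let ?f = "row_length p"
  have p: "is_partition p" using assms(1) by (simp add: t_core_def)
  note anti = antimonoD[OF antimono_row_length[OF p]]
  have end0: "?f (length p) = 0" by (simp add: row_length_def)
  have no_horizontal: "?f i \<le> Suc (?f (Suc i))" for i
  proof (rule ccontr)
    assume "\<not> ?thesis"
    then have gap: "?f (Suc i) \<le> ?f i - 2" "2 \<le> ?f i" by simp_all
    let ?g = "?f(i := ?f i - 2)"
    have "antimono ?g"
      unfolding antimono_iff_le_Suc
    proof
      show "?g (Suc k) \<le> ?g k" for k
        using anti[of k "Suc k"] gap by auto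
    qed
    moreover have "?g (length p) = 0" using end0 by (cases "i = length p") auto
    ultimately obtain p' where p': "is_partition p'" "young_diagram p' = {(i, j). j < ?g i}"
      by (rule partition_of_row_lengths)
    have "\<not> t_core 2 p"
      by (rule removable_domino[OF p p'(1), of "(i, ?f i - 2)" "(i, ?f i - 1)"])
         (use gap p'(2) in \<open>auto simp: cell_adj_def mem_young_diagram_iff split: if_splits\<close>)
    then show False using assms(1) by simp
  qed
  have no_vertical: "?f (Suc i) \<noteq> ?f i" if "0 < ?f i" for i
  proof
    assume eq: "?f (Suc i) = ?f i"
    \<comment> \<open>Only the last two rows of a block of equal rows can both lose a cell.\<close>
    obtain l where l: "?f l = ?f i" "?f (Suc l) = ?f i" and less: "?f (Suc (Suc l)) < ?f i"
      using antimono_row_length[OF p] end0 \<open>0 < ?f i\<close> eq by (rule antimono_last_equal_pair)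
    let ?g = "?f(l := ?f i - 1, Suc l := ?f i - 1)"
    have "antimono ?g"
      unfolding antimono_iff_le_Suc
    proof
      fix k
      consider "k = Suc l" | "k = l" | "Suc k = l" | "k \<noteq> Suc l" "k \<noteq> l" "Suc k \<noteq> l" by blast
      then show "?g (Suc k) \<le> ?g k"
      proof cases
        case 1
        then show ?thesis using less by simp
      next
        case 3
        then show ?thesis using anti[of k l] l(1) by (auto simp: le_diff_conv)
      qed (use anti[of k "Suc k"] in simp_all)
    qed
    moreover have "?g (length p) = 0"
      using end0 l \<open>0 < ?f i\<close> by (cases "length p = l"; cases "length p = Suc l") simp_all
    ultimately obtain p' where p': "is_partition p'" "young_diagram p' = {(i, j). j < ?g i}"
      by (rule partition_of_row_lengths)
    have "\<not> t_core 2 p"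
    proof (rule removable_domino[OF p p'(1)])
      show "((l, ?f i - 1), (Suc l, ?f i - 1)) \<in> cell_adj" by (simp add: cell_adj_def)
      show "{(l, ?f i - 1), (Suc l, ?f i - 1)} \<subseteq> young_diagram p"
        using l \<open>0 < ?f i\<close> by (simp add: mem_young_diagram_iff)
      have "j < ?g k \<longleftrightarrow> j < ?f k \<and> (k, j) \<noteq> (l, ?f i - 1) \<and> (k, j) \<noteq> (Suc l, ?f i - 1)" for k j
      proof -
        consider "k = l" | "k = Suc l" | "k \<noteq> l" "k \<noteq> Suc l" by blast
        then show ?thesis using l by cases auto
      qed
      then show "young_diagram p' = young_diagram p - {(l, ?f i - 1), (Suc l, ?f i - 1)}"
        unfolding p'(2) by (auto simp only: set_eq_iff mem_young_diagram_iff Diff_iff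
            insert_iff empty_iff mem_Collect_eq prod.case split_paired_All)
    qed
    then show False using assms(1) by simp
  qed
  have "0 < ?f i" using row_length_pos_iff[OF p] assms(2) by simp
  then show ?thesis
    using no_horizontal[of i] no_vertical[of i] anti[of i "Suc i"] by simp
qed

definition staircase :: "nat \<Rightarrow> nat list" where
  "staircase k = map (\<lambda>i. k - i) [0..<k]"

lemma staircase_nth: "i < k \<Longrightarrow> staircase k ! i = k - i"
  by (simp add: staircase_def)

lemma t_core_2_imp_staircase:
  assumes "t_core 2 p"
  shows "p = staircase (length p)"
proof (rule nth_equalityI)
  have "row_length p (length p - k) = k" if "k \<le> length p" for k
    using that
  proof (induction k)
    case 0
    show ?case by (simp add: row_length_def)
  next
    case (Suc k)
    then have "Suc (length p - Suc k) = length p - k" by simp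
    with Suc t_core_2_row_diff[OF assms, of "length p - Suc k"] show ?case by simp
  qed
  then have "row_length p (length p - (length p - i)) = length p - i" for i
    by simp
  then show "p ! i = staircase (length p) ! i" if i: "i < length p" for i
    using i by (metis staircase_nth row_length_def diff_diff_cancel less_imp_le_nat)
qed (simp add: staircase_def)

lemma young_diagram_staircase: "(i, j) \<in> young_diagram (staircase k) \<longleftrightarrow> i + j < k"
  by (auto simp: young_diagram_def staircase_def)

text \<open>
  Beside or below a domino in a staircase there is room for one further cell: if \<open>(i, j)\<close> and
  \<open>(i, j + 1)\<close> belong to the diagram \<open>{(i, j). i + j < k}\<close>, then so does \<open>(i + 1, j)\<close>, and
  symmetrically for vertical dominoes. That cell would remain after the domino is removed although
  \<open>(i, j)\<close> does not, and then no partition is left.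
\<close>

lemma t_core_2_staircase: "t_core 2 (staircase k)"
  unfolding t_core_def
proof (intro conjI notI)
  show "is_partition (staircase k)"
    by (auto simp: is_partition_def staircase_def sorted_wrt_iff_nth_less)
  assume "\<exists>R. removable_rim_hook (staircase k) 2 R"
  then obtain R p' where R: "R \<subseteq> young_diagram (staircase k)" "card R = 2" "cells_connected R"
    and p': "is_partition p'" "young_diagram p' = young_diagram (staircase k) - R"
    unfolding removable_rim_hook_def by blast
  obtain a b where ab: "R = {a, b}" "(a, b) \<in> cell_adj"
    using R(3,2) by (rule cells_connected_card_2E)
  from ab(2) show False
  proof (cases rule: cell_adj_orderedE)
    case (1 i j)
    then have "(Suc i, j) \<in> young_diagram p'" "(i, j) \<notin> young_diagram p'"
      using R(1) by (auto simp: ab(1) p'(2) young_diagram_staircase)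
    then show False using young_diagram_down_closed[OF p'(1), of "Suc i" j i j] by simp
  next
    case (2 i j)
    then have "(i, Suc j) \<in> young_diagram p'" "(i, j) \<notin> young_diagram p'"
      using R(1) by (auto simp: ab(1) p'(2) young_diagram_staircase)
    then show False using young_diagram_down_closed[OF p'(1), of i "Suc j" i j] by simp
  qed
qed

lemma sum_list_staircase: "sum_list (staircase k) = k * (k + 1) div 2"
proof -
  have "sum_list (staircase k) = (\<Sum>i = 0..<k. k - i)"
    by (simp add: staircase_def interv_sum_list_conv_sum_set_nat)
  also have "\<dots> = (\<Sum>i = 0..<k. Suc i)"
    by (rule sum.reindex_bij_witness[of _ "\<lambda>i. k - Suc i" "\<lambda>i. k - Suc i"]) auto
  also have "\<dots> = k * (k + 1) div 2"
    by (induction k) auto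
  finally show ?thesis .
qed

lemma c2_eq_psi: "c2 = psi"
proof -
  have "bij_betw staircase UNIV {p. t_core 2 p}"
    by (rule bij_betw_byWitness[where f' = length])
       (use t_core_2_imp_staircase t_core_2_staircase in \<open>auto simp: staircase_def\<close>)
  then show ?thesis
    unfolding c2_def psi_def
    by (rule gf_bij[symmetric]) (simp only: sum_list_staircase)
qed

section \<open>The two rank generating functions\<close>

theorem corollary4p7:
  shows
    "r4 0 oo fps_X ^ 2 = gf {(x, y, z). even (x + y + z)} (\<lambda>(x, y, z). (x::int)\<^sup>2 + y\<^sup>2 + z\<^sup>2) \<and>
     r4 0 oo fps_X ^ 2 = theta_series fcc_lattice \<and>
     (\<forall>n. fps_nth (r4 0) n = int (card {v \<in> fcc_lattice. dist v 0 = sqrt (2 * real n)})) \<and>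
     r4 0 = (phi oo fps_X ^ 2) ^ 3 + 12 * fps_X * (phi oo fps_X ^ 2) * (psi oo fps_X ^ 4) ^ 2 \<and>
     r4 1 = 4 * c2 ^ 3 \<and>
     4 * c2 ^ 3 = 4 * psi ^ 3 \<and>
     (\<forall>n. fps_nth (r4 1) n =
        4 * int (card {(a, b, c). a \<in> triangular \<and> b \<in> triangular \<and> c \<in> triangular \<and> a + b + c = n}))"
proof (intro conjI allI)
  show "r4 0 oo fps_X ^ 2 = gf {(x, y, z). even (x + y + z)} (\<lambda>(x, y, z). (x::int)\<^sup>2 + y\<^sup>2 + z\<^sup>2)"
    using r4_0_compose by (simp only: fcc_int_def)
  show "r4 0 oo fps_X ^ 2 = theta_series fcc_lattice"
    by (simp only: r4_0_compose theta_series_fcc_lattice)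
  show "r4 1 = 4 * c2 ^ 3" "4 * c2 ^ 3 = 4 * psi ^ 3"
    by (simp_all only: r4_1_eq c2_eq_psi)
  show "fps_nth (r4 1) n =
      4 * int (card {(a, b, c). a \<in> triangular \<and> b \<in> triangular \<and> c \<in> triangular \<and> a + b + c = n})" for n
    by (simp only: r4_1_eq numeral_fps_const fps_mult_left_const_nth psi_cube_nth)
qed (fact r4_0_nth r4_0_eq)+

end
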